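(* Let $P,Q,R$ be cones, $f:\mathcal B P\to Q$ pre-stable from $P$ to $Q$ and $g:\mathcal B Q\to R$ pre-stable from $Q$ to $R$. If $f(\mathcal B P)\subseteq\mathcal B Q$, then $g\circ f$ is pre-stable from $P$ to $R$.
   Context: A cone is an $\mathbb R_{\ge0}$-semimodule $P$ with $\|\cdot\|_P:P\to\mathbb R_{\ge0}$ such that for all $x,x',y,y'$ and $\alpha\ge0$: $x+y=x+y'\Rightarrow y=y'$; $\|\alpha x\|=\alpha\|x\|$; $\|x\|=0\Rightarrow x=0$; $\|x+x'\|\le\|x\|+\|x'\|$; $\|x\|\le\|x+x'\|$. $\mathcal B P=\{x:\|x\|_P\le1\}$; cone order $x\le_P x'$ iff $x'=x+y$ for some $y$. For $f:\mathcal B P\to Q$, $\vec u\in P^n$ and $x\in P$ with $x+\sum_iu_i\in\mathcal B P$, $\Delta^\epsilon f(x;\vec u)=\sum_{I\in\mathcal C^\epsilon_n}f(x+\sum_{i\in I}u_i)$ for $\epsilon\in\{+,-\}$, where $\mathcal C^+_n$ (resp. $\mathcal C^-_n$) is the set of $I\subseteq\{1,\dots,n\}$ with $n-|I|$ even (resp. odd). $f$ is pre-stable from $P$ to $Q$ if $\Delta^-f(x;\vec u)\le_Q\Delta^+f(x;\vec u)$ for all $n\ge1$ and all such $\vec u,x$. *)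

theory Defs
  imports Complex_Main
begin

text \<open>
  The semiring of nonnegative reals is rendered by \<^typ>\<open>real\<close> with guards; scalar
  multiplication by a negative real is left unspecified. The operations are not those of the
  library classes \<open>scaleR\<close> and \<open>norm\<close>, whose constants are constrained to real vector spaces.
\<close>

class cone = comm_monoid_add +
  fixes cone_scale :: "real \<Rightarrow> 'a \<Rightarrow> 'a"  (infixr "\<odot>" 75)
    and cone_norm :: "'a \<Rightarrow> real"
  assumes cone_scale_add_right: "a \<ge> 0 \<Longrightarrow> a \<odot> (x + y) = a \<odot> x + a \<odot> y"
    and cone_scale_add_left: "a \<ge> 0 \<Longrightarrow> b \<ge> 0 \<Longrightarrow> (a + b) \<odot> x = a \<odot> x + b \<odot> x"
    and cone_scale_scale: "a \<ge> 0 \<Longrightarrow> b \<ge> 0 \<Longrightarrow> (a * b) \<odot> x = a \<odot> (b \<odot> x)"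
    and cone_scale_one: "1 \<odot> x = x"
    and cone_scale_zero_left: "0 \<odot> x = 0"
    and cone_scale_zero_right: "a \<ge> 0 \<Longrightarrow> a \<odot> 0 = 0"
    and cone_cancel: "x + y = x + y' \<Longrightarrow> y = y'"
    and cone_norm_nonneg: "cone_norm x \<ge> 0"
    and cone_norm_scale: "a \<ge> 0 \<Longrightarrow> cone_norm (a \<odot> x) = a * cone_norm x"
    and cone_norm_eq_zero: "cone_norm x = 0 \<Longrightarrow> x = 0"
    and cone_norm_triangle: "cone_norm (x + x') \<le> cone_norm x + cone_norm x'"
    and cone_norm_mono: "cone_norm x \<le> cone_norm (x + x')"

definition unit_ball :: "'a::cone set" where
  "unit_ball = {x. cone_norm x \<le> 1}"

definition cone_le :: "'a::cone \<Rightarrow> 'a \<Rightarrow> bool"  (infix "\<sqsubseteq>" 50) where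
  "x \<sqsubseteq> x' \<longleftrightarrow> (\<exists>y. x' = x + y)"

definition index_sets_pos :: "nat \<Rightarrow> nat set set" where
  "index_sets_pos n = {I. I \<subseteq> {1..n} \<and> even (n - card I)}"

definition index_sets_neg :: "nat \<Rightarrow> nat set set" where
  "index_sets_neg n = {I. I \<subseteq> {1..n} \<and> odd (n - card I)}"

text \<open>
  A family in \<open>P\<^sup>n\<close> is a function on \<^typ>\<open>nat\<close> of which only the values at \<open>1, \<dots>, n\<close> are used.
  Likewise a map defined on the unit ball is a total function whose values outside the ball are
  irrelevant: in \<open>pre_stable\<close> below, every point \<open>x + (\<Sum>i\<in>I. u i)\<close> lies in the ball by
  monotonicity of the norm.
\<close>

definition delta_pos :: "('a::cone \<Rightarrow> 'b::cone) \<Rightarrow> nat \<Rightarrow> 'a \<Rightarrow> (nat \<Rightarrow> 'a) \<Rightarrow> 'b" where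
  "delta_pos f n x u = (\<Sum>I\<in>index_sets_pos n. f (x + (\<Sum>i\<in>I. u i)))"

definition delta_neg :: "('a::cone \<Rightarrow> 'b::cone) \<Rightarrow> nat \<Rightarrow> 'a \<Rightarrow> (nat \<Rightarrow> 'a) \<Rightarrow> 'b" where
  "delta_neg f n x u = (\<Sum>I\<in>index_sets_neg n. f (x + (\<Sum>i\<in>I. u i)))"

definition pre_stable :: "('a::cone \<Rightarrow> 'b::cone) \<Rightarrow> bool" where
  "pre_stable f \<longleftrightarrow>
     (\<forall>n\<ge>1. \<forall>u x. x + (\<Sum>i=1..n. u i) \<in> unit_ball \<longrightarrow> delta_neg f n x u \<sqsubseteq> delta_pos f n x u)"

end

theory Submission
  imports Defs
begin

text \<open>
  A map \<open>f\<close> is pre-stable iff along every finite family \<open>u\<close> it has a Moebius expansion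
  \<open>f (x + (\<Sum>i\<in>I. u i)) = (\<Sum>J\<subseteq>I. a J)\<close> whose coefficients \<open>a J\<close>, the iterated differences of \<open>f\<close>,
  lie in the cone. If \<open>a\<close> are the coefficients of \<open>f\<close> along \<open>u\<close>, and \<open>b\<close> those of \<open>g\<close> at \<open>0\<close>
  along the family \<open>a\<close>, then \<open>g (f (x + (\<Sum>i\<in>I. u i)))\<close> is the sum of the \<open>b T\<close> over the sets \<open>T\<close>
  of subsets of \<open>I\<close>, that is, over the \<open>T\<close> with \<open>\<Union>T \<subseteq> I\<close>. Grouping by the union \<open>J = \<Union>T\<close> gives
  an expansion of \<open>g \<circ> f\<close>.
\<close>

lemma sum_Pow_insert:
  fixes F :: "'a set \<Rightarrow> 'b::comm_monoid_add"
  assumes "finite A" "i \<notin> A"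
  shows "sum F (Pow (insert i A)) = sum F (Pow A) + (\<Sum>I\<in>Pow A. F (insert i I))"
proof -
  have "inj_on (insert i) (Pow A)"
    using assms(2) by (auto simp: inj_on_def dest: insert_ident[THEN iffD1, rotated 2])
  moreover have "Pow A \<inter> insert i ` Pow A = {}"
    using assms(2) by auto
  ultimately show ?thesis
    using assms(1) by (simp add: Pow_insert sum.union_disjoint sum.reindex)
qed

text \<open>
  The parity of \<open>card A + card I\<close> is that of \<open>card A - card I\<close> for \<open>I \<subseteq> A\<close>.
\<close>

definition parity_sum :: "bool \<Rightarrow> ('a set \<Rightarrow> 'b::comm_monoid_add) \<Rightarrow> 'a set \<Rightarrow> 'b" where
  "parity_sum p F A = (\<Sum>I\<in>Pow A. if even (card A + card I) = p then F I else 0)"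

lemma parity_sum_empty [simp]: "parity_sum p F {} = (if p then F {} else 0)"
  by (simp add: parity_sum_def)

text \<open>For \<open>I\<close> avoiding \<open>i\<close> only the ambient cardinality grows, so
  the parity flips; for \<open>insert i I\<close> both cardinalities grow and it is kept.\<close>

lemma parity_sum_insert:
  assumes "finite A" "i \<notin> A"
  shows "parity_sum p F (insert i A) = parity_sum (\<not> p) F A + parity_sum p (\<lambda>I. F (insert i I)) A"
proof -
  have card: "card (insert i I) = Suc (card I)" if "I \<in> Pow A" for I
    using that assms by (auto intro!: card_insert_disjoint dest: finite_subset)
  show ?thesis
    unfolding parity_sum_def sum_Pow_insert[OF assms]
    by (intro arg_cong2[where f = "(+)"] sum.cong) (use assms card in auto)
qed

lemma parity_sum_add:
  "parity_sum p (\<lambda>I. F I + G I) A = parity_sum p F A + parity_sum p G A"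
  unfolding parity_sum_def sum.distrib[symmetric] by (intro sum.cong) auto

lemma parity_sum_cong:
  assumes "\<And>I. I \<subseteq> A \<Longrightarrow> F I = G I"
  shows "parity_sum p F A = parity_sum p G A"
  unfolding parity_sum_def using assms by (intro sum.cong) auto

lemma parity_sum_reindex:
  assumes "bij_betw h B A"
  shows "parity_sum p (\<lambda>I. F (h ` I)) B = parity_sum p F A"
proof -
  have "bij_betw (image h) (Pow B) (Pow A)"
    using assms by (rule bij_betw_Pow)
  moreover have "card (h ` I) = card I" if "I \<in> Pow B" for I
    using that assms by (auto intro!: card_image intro: inj_on_subset simp: bij_betw_def)
  moreover have "card A = card B"
    using assms by (simp add: bij_betw_same_card)
  ultimately show ?thesis
    unfolding parity_sum_def
    by (subst sum.reindex_bij_betw[of "image h" "Pow B" "Pow A", symmetric]) (auto intro!: sum.cong)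
qed

text \<open>
  The induction passes from \<open>F\<close> to the difference of \<open>F (insert i _)\<close> and \<open>F\<close>, so the
  statement is about formal differences \<open>F - F'\<close>.
\<close>

lemma moebius_inversion_difference:
  fixes F F' a :: "'a set \<Rightarrow> 'b::cone"
  assumes "finite A"
    and "\<And>J. J \<subseteq> A \<Longrightarrow> parity_sum True F J + parity_sum False F' J
      = parity_sum False F J + parity_sum True F' J + a J"
  shows "F A = F' A + sum a (Pow A)"
  using assms
proof (induction A arbitrary: F F' a rule: finite_induct)
  case empty
  from empty[of "{}"] show ?case by simp
next
  case (insert i A)
  have diff: "F A = F' A + sum a (Pow A)"
    by (rule insert.IH) (use insert.prems in blast)
  have "F (insert i A) + F' A = (F' (insert i A) + F A) + (\<Sum>J\<in>Pow A. a (insert i J))"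
  proof (rule insert.IH)
    fix J assume J: "J \<subseteq> A"
    then have "finite J" "i \<notin> J" "insert i J \<subseteq> insert i A"
      using insert.hyps by (auto dest: finite_subset)
    then show "parity_sum True (\<lambda>J. F (insert i J) + F' J) J
        + parity_sum False (\<lambda>J. F' (insert i J) + F J) J
      = parity_sum False (\<lambda>J. F (insert i J) + F' J) J
        + parity_sum True (\<lambda>J. F' (insert i J) + F J) J + a (insert i J)"
      using insert.prems[of "insert i J"] by (simp add: parity_sum_insert parity_sum_add ac_simps)
  qed
  \<comment> \<open>Once \<open>diff\<close> rewrites \<open>F A\<close>, both sides contain
    \<open>F' A\<close>; cancelling it stands in for subtraction.\<close>
  then have "F' A + F (insert i A) = F' A + (F' (insert i A) + sum a (Pow (insert i A)))"
    using insert.hyps by (simp add: diff sum_Pow_insert ac_simps)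
  then show ?case by (rule cone_cancel)
qed

lemma moebius_inversion:
  fixes F a :: "'a set \<Rightarrow> 'b::cone"
  assumes "finite A" and "\<And>J. J \<subseteq> A \<Longrightarrow> parity_sum True F J = parity_sum False F J + a J"
  shows "F A = sum a (Pow A)"
proof -
  have "parity_sum p (\<lambda>_. 0) J = (0::'b)" for p and J :: "'a set"
    by (simp add: parity_sum_def)
  then show ?thesis
    using moebius_inversion_difference[of A F "\<lambda>_. 0" a] assms by simp
qed

text \<open>Converse of the inversion. The subsets without \<open>i\<close> contribute equally to
  both parities of \<open>insert i A\<close>, so only the claim for \<open>G\<close>
  remains.\<close>

lemma parity_sum_moebius:
  fixes a :: "'a set \<Rightarrow> 'b::comm_monoid_add"
  assumes "finite A"
  shows "parity_sum True (\<lambda>I. sum a (Pow I)) A = parity_sum False (\<lambda>I. sum a (Pow I)) A + a A"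
  using assms
proof (induction A arbitrary: a rule: finite_induct)
  case empty
  show ?case by simp
next
  case (insert i A)
  define G where "G I = (\<Sum>J\<in>Pow I. a (insert i J))" for I
  have "parity_sum p (\<lambda>I. sum a (Pow (insert i I))) A
      = parity_sum p (\<lambda>I. sum a (Pow I)) A + parity_sum p G A" for p
    unfolding parity_sum_add[symmetric] G_def
    by (rule parity_sum_cong, rule sum_Pow_insert) (use insert.hyps in \<open>auto dest: finite_subset\<close>)
  moreover have "parity_sum True G A = parity_sum False G A + a (insert i A)"
    unfolding G_def by (rule insert.IH)
  ultimately show ?case
    using insert.hyps by (simp add: parity_sum_insert ac_simps)
qed

lemma delta_pos_eq_parity_sum:
  "delta_pos f n x u = parity_sum True (\<lambda>I. f (x + sum u I)) {1..n}"
proof -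
  \<comment> \<open>Subtraction on \<open>nat\<close> truncates, so \<open>card I \<le> n\<close> is
    essential here.\<close>
  have "even (n - card I) = even (n + card I)" if "I \<subseteq> {1..n}" for I
    using card_mono[OF _ that] by simp
  then have "index_sets_pos n = {I \<in> Pow {1..n}. even (n + card I)}"
    unfolding index_sets_pos_def by blast
  then show ?thesis
    unfolding delta_pos_def parity_sum_def by (subst sum.inter_filter[symmetric]) auto
qed

lemma delta_neg_eq_parity_sum:
  "delta_neg f n x u = parity_sum False (\<lambda>I. f (x + sum u I)) {1..n}"
proof -
  have "odd (n - card I) = odd (n + card I)" if "I \<subseteq> {1..n}" for I
    using card_mono[OF _ that] by simp
  then have "index_sets_neg n = {I \<in> Pow {1..n}. odd (n + card I)}"
    unfolding index_sets_neg_def by blast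
  then show ?thesis
    unfolding delta_neg_def parity_sum_def by (subst sum.inter_filter[symmetric]) auto
qed

lemma add_sum_subset_in_unit_ball:
  assumes "finite A" "x + sum u A \<in> unit_ball" "I \<subseteq> A"
  shows "x + sum u I \<in> unit_ball"
proof -
  have "x + sum u A = (x + sum u I) + sum u (A - I)"
    using sum.subset_diff[OF assms(3,1), of u] by (simp add: ac_simps)
  then show ?thesis
    using assms(2) cone_norm_mono[of "x + sum u I" "sum u (A - I)"] by (simp add: unit_ball_def)
qed

text \<open>Arbitrary finite index sets are needed because \<open>g\<close> will be applied along a
  family indexed by sets. An enumeration of \<open>A\<close> reduces them to
  \<open>{1..n}\<close>.\<close>

lemma pre_stable_parity_sum_le:
  assumes "pre_stable f" "finite A" "x + sum u A \<in> unit_ball"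
  shows "parity_sum False (\<lambda>I. f (x + sum u I)) A \<sqsubseteq> parity_sum True (\<lambda>I. f (x + sum u I)) A"
proof (cases "A = {}")
  \<comment> \<open>\<open>pre_stable\<close> starts at \<open>n = 1\<close>; for the empty family
    the odd sum is 0, which lies below everything.\<close>
  case True
  then show ?thesis by (auto simp: cone_le_def)
next
  case False
  obtain h where h: "bij_betw h {1..card A} A"
    using ex_bij_betw_nat_finite_1[OF assms(2)] by blast
  have reindex: "parity_sum p (\<lambda>I. f (x + sum (u \<circ> h) I)) {1..card A}
      = parity_sum p (\<lambda>I. f (x + sum u I)) A" for p
  proof -
    have "sum (u \<circ> h) I = sum u (h ` I)" if "I \<subseteq> {1..card A}" for I
      using h that by (metis bij_betw_def inj_on_subset sum.reindex)
    then have "parity_sum p (\<lambda>I. f (x + sum (u \<circ> h) I)) {1..card A}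
        = parity_sum p (\<lambda>I. f (x + sum u (h ` I))) {1..card A}"
      by (intro parity_sum_cong) simp
    also have "\<dots> = parity_sum p (\<lambda>I. f (x + sum u I)) A"
      by (rule parity_sum_reindex[OF h])
    finally show ?thesis .
  qed
  have "card A \<ge> 1"
    using False assms(2) by (simp add: Suc_le_eq card_gt_0_iff)
  moreover have "x + (\<Sum>i=1..card A. (u \<circ> h) i) \<in> unit_ball"
    using assms(3) sum.reindex_bij_betw[OF h, of u] by simp
  ultimately have "delta_neg f (card A) x (u \<circ> h) \<sqsubseteq> delta_pos f (card A) x (u \<circ> h)"
    using assms(1) unfolding pre_stable_def by blast
  then show ?thesis
    by (simp only: delta_neg_eq_parity_sum delta_pos_eq_parity_sum reindex)
qed

text \<open>The order relation on each subfamily \<open>J\<close> yields a witness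
  \<open>a J\<close>; these witnesses are the coefficients, by inversion.\<close>

lemma pre_stable_moebius:
  assumes "pre_stable f" "finite A" "x + sum u A \<in> unit_ball"
  obtains a where "\<And>I. I \<subseteq> A \<Longrightarrow> f (x + sum u I) = sum a (Pow I)"
proof -
  let ?F = "\<lambda>I. f (x + sum u I)"
  have "\<exists>y. parity_sum True ?F J = parity_sum False ?F J + y" if "J \<subseteq> A" for J
  proof -
    have "finite J" "x + sum u J \<in> unit_ball"
      using assms that by (auto intro: add_sum_subset_in_unit_ball finite_subset)
    from pre_stable_parity_sum_le[OF assms(1) this] show ?thesis
      by (simp add: cone_le_def)
  qed
  then obtain a where a: "\<And>J. J \<subseteq> A \<Longrightarrow> parity_sum True ?F J = parity_sum False ?F J + a J"
    by metis
  show thesis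
  proof (rule that)
    fix I assume "I \<subseteq> A"
    then show "f (x + sum u I) = sum a (Pow I)"
      using assms(2) a by (intro moebius_inversion[of I ?F a]) (auto dest: finite_subset)
  qed
qed

text \<open>The top coefficient \<open>a {1..n}\<close> witnesses the required order
  relation.\<close>

lemma pre_stableI_moebius:
  fixes f :: "'a::cone \<Rightarrow> 'b::cone"
  assumes "\<And>(n::nat) u x. x + (\<Sum>i=1..n. u i) \<in> unit_ball \<Longrightarrow>
    \<exists>a. \<forall>I\<subseteq>{1..n}. f (x + sum u I) = sum a (Pow I)"
  shows "pre_stable f"
  unfolding pre_stable_def
proof (intro allI impI)
  fix n :: nat and u :: "nat \<Rightarrow> 'a" and x :: 'a
  assume "x + (\<Sum>i=1..n. u i) \<in> unit_ball"
  from assms[OF this] obtain a where a: "\<And>I. I \<subseteq> {1..n} \<Longrightarrow> f (x + sum u I) = sum a (Pow I)"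
    by auto
  have "parity_sum p (\<lambda>I. f (x + sum u I)) {1..n} = parity_sum p (\<lambda>I. sum a (Pow I)) {1..n}" for p
    by (rule parity_sum_cong) (rule a)
  then show "delta_neg f n x u \<sqsubseteq> delta_pos f n x u"
    unfolding cone_le_def delta_neg_eq_parity_sum delta_pos_eq_parity_sum
    using parity_sum_moebius[of "{1..n}" a] by auto
qed

lemma sum_Pow_Pow_group_by_Union:
  fixes b :: "'a set set \<Rightarrow> 'b::comm_monoid_add"
  assumes "finite I"
  shows "sum b (Pow (Pow I)) = (\<Sum>J\<in>Pow I. sum b {T. \<Union>T = J})"
proof -
  \<comment> \<open>The fibre over \<open>J\<close> does not depend on \<open>I\<close>, so one
    coefficient function serves all \<open>I\<close>.\<close>
  have "{T \<in> Pow (Pow I). \<Union>T = J} = {T. \<Union>T = J}" if "J \<in> Pow I" for J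
    using that by auto
  then have "(\<Sum>J\<in>Pow I. sum b {T. \<Union>T = J}) = (\<Sum>J\<in>Pow I. sum b {T \<in> Pow (Pow I). \<Union>T = J})"
    by (intro sum.cong) auto
  also have "\<dots> = sum b (Pow (Pow I))"
    using assms by (intro sum.group) auto
  finally show ?thesis ..
qed

theorem theorem4p26:
  fixes f :: "'p::cone \<Rightarrow> 'q::cone" and g :: "'q \<Rightarrow> 'r::cone"
  assumes "pre_stable f" and "pre_stable g" and "f ` unit_ball \<subseteq> unit_ball"
  shows "pre_stable (g \<circ> f)"
proof (rule pre_stableI_moebius)
  fix n :: nat and u :: "nat \<Rightarrow> 'p" and x :: 'p
  let ?A = "{1..n}"
  assume ball: "x + sum u ?A \<in> unit_ball"
  obtain a where a: "\<And>I. I \<subseteq> ?A \<Longrightarrow> f (x + sum u I) = sum a (Pow I)"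
    using pre_stable_moebius[OF assms(1) _ ball] by blast
  \<comment> \<open>The total of the coefficients is the value of \<open>f\<close> at the top point,
    which lies in the ball by the assumption on the image of \<open>f\<close>.\<close>
  have "0 + sum a (Pow ?A) \<in> unit_ball"
    using a[of ?A] ball assms(3) by auto
  then obtain b where b: "\<And>S. S \<subseteq> Pow ?A \<Longrightarrow> g (0 + sum a S) = sum b (Pow S)"
    using pre_stable_moebius[OF assms(2), of "Pow ?A" 0 a] by blast
  have "(g \<circ> f) (x + sum u I) = (\<Sum>J\<in>Pow I. sum b {T. \<Union>T = J})" if "I \<subseteq> ?A" for I
  proof -
    have "(g \<circ> f) (x + sum u I) = sum b (Pow (Pow I))"
      using a[OF that] b[of "Pow I"] that by (simp add: Pow_mono)
    also have "\<dots> = (\<Sum>J\<in>Pow I. sum b {T. \<Union>T = J})"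
      using that by (intro sum_Pow_Pow_group_by_Union) (auto dest: finite_subset)
    finally show ?thesis .
  qed
  then show "\<exists>c. \<forall>I\<subseteq>?A. (g \<circ> f) (x + sum u I) = sum c (Pow I)"
    by blast
qed

end
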